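(* Let $\lambda$ be a cardinal with $2^{<\lambda}=\lambda>\omega$. Let $(Y,\mathfrak{M})$ be a $\lambda^+$-Borel space, i.e. $\mathfrak{M}$ is the $\lambda^+$-algebra on $Y$ generated by a $T_0$ topology $\tau$ on $Y$ of weight at most $\lambda$. Then there is no continuous $\lambda^+$-measure on $(Y,\mathfrak{M})$ (where $Y$ carries such a topology $\tau$, and for any choice of positively totally ordered monoid $\mathbb{S}$ with infinitary sum $\mathsf{Sum}$ in which the measure takes its values).
   Context: **Monoids and sums.** A positively totally ordered monoid is $\mathbb{S}=(S,0,+,\leq)$ where $+$ is associative (not necessarily commutative) with neutral element $0$, $\leq$ is a total order, $a\leq b$ and $c\leq d$ imply $a+c\leq b+d$, $0$ is the minimum of $\leq$, and $S\neq\{0\}$. ${}^{<\mathrm{On}}\mathbb{S}$ is the class of all sequences of elements of $S$ of ordinal length; $\mathrm{lh}(s)$ is the length of $s$. An infinitary sum on $\mathbb{S}$ is a partial function $\mathsf{Sum}:{}^{<\mathrm{On}}\mathbb{S}\to\mathbb{S}$ such that: (S1) $\mathsf{Sum}(\emptyset)=0$ and $\mathsf{Sum}(s)=s_0+\dots+s_n$ for every non-empty finite $s=(s_i)_{i\leq n}\in\mathrm{dom}(\mathsf{Sum})$; (S2) (continuity) for all $s\in\mathrm{dom}(\mathsf{Sum})$ of limit length, if $s\restriction\alpha\in\mathrm{dom}(\mathsf{Sum})$ for cofinally many $\alpha<\mathrm{lh}(s)$, then $\mathsf{Sum}(s)=\sup\{\mathsf{Sum}(s\restriction\alpha)\mid\alpha<\mathrm{lh}(s),\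 s\restriction\alpha\in\mathrm{dom}(\mathsf{Sum})\}$. **Measures.** A $\lambda^+$-algebra on $Y$ is a family of subsets of $Y$ closed under complements and under unions and intersections of size at most $\lambda$. Given a topology $\tau$ on $Y$ and a $\lambda^+$-algebra $\mathfrak{M}\supseteq\tau$, a $\lambda^+$-measure on $(Y,\mathfrak{M})$ (with values in $(\mathbb{S},\mathsf{Sum})$) is a partial function $\mu:\mathscr{P}(Y)\to\mathbb{S}$ with $\mathfrak{M}\subseteq\mathrm{dom}(\mu)$ such that: (M1) $\mu(\emptyset)=0$; (M2) $\mu(Y)>0$; (M3) $A\subseteq B$ implies $\mu(A)\leq\mu(B)$ for all $A,B\in\mathfrak{M}$; (M4) for every family $(A_i)_{i<\gamma}$ of pairwise disjoint sets of $\mathfrak{M}$ of length an ordinal $\gamma<\lambda^+$, we have $\langle\mu(A_i)\mid i<\gamma\rangle\in\mathrm{dom}(\mathsf{Sum})$ and $\mu(\bigcup_{i<\gamma}A_i)=\mathsf{Sum}(\langle\mu(A_i)\mid i<\gamma\rangle)$; (M5) for every $x\in Y$ with $\{x\}\in\mathfrak{M}$ and every $\tau$-open local basis $\{A_i\mid i<\gamma\}$ at $x$ with $\gamma<\lambda^+$, $\mu(\{x\})=\inf_{i<\gamma}\mu(A_i)$. It is continuous if $\{x\}\in\mathfrak{M}$ and $\mu(\{x\})=0$ for every $x\in Y$. Here $2^{<\lambda}=\sup\{2^{\theta}\mid\theta<\lambda\text{ a cardinal}\}$. *)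

theory Defs
  imports "HOL-Analysis.Analysis" "HOL-Library.Lub_Glb"
begin

unbundle cardinal_syntax

section \<open>Cardinals\<close>

text \<open>
  Cardinals are relations satisfying \<^const>\<open>Card_order\<close>. As any cardinal that does not lie
  above \<open>\<kappa>\<close> is represented on the type of \<open>\<kappa>\<close>, letting the upper bounds \<open>\<kappa>'\<close> below
  range over that type only is no restriction. The same applies to the cardinals below
  \<open>lam\<close> in \<open>powers_below\<close>.
\<close>

definition is_card_sup :: "'a rel set \<Rightarrow> 'b rel \<Rightarrow> bool" where
  "is_card_sup K \<kappa> \<longleftrightarrow>
     Card_order \<kappa> \<and> (\<forall>r\<in>K. r \<le>o \<kappa>) \<and>
     (\<forall>\<kappa>'::'b rel. Card_order \<kappa>' \<and> (\<forall>r\<in>K. r \<le>o \<kappa>') \<longrightarrow> \<kappa> \<le>o \<kappa>')"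

definition powers_below :: "'l rel \<Rightarrow> ('l \<Rightarrow> bool) rel set" where
  "powers_below lam = {ctwo ^c \<theta> | \<theta>::'l rel. Card_order \<theta> \<and> \<theta> <o lam}"


section \<open>Ordinals and sequences of ordinal length\<close>

text \<open>
  The ordinals are the elements of a type \<open>'o\<close> of class \<^class>\<open>wellorder\<close>, the element \<open>\<gamma>\<close>
  being identified with its initial segment \<open>{..<\<gamma>}\<close>. Such a type is isomorphic to an initial
  segment of the class of all ordinals; if its cardinality is greater than \<open>lam\<close>, then it
  contains all ordinals below the successor cardinal of \<open>lam\<close>. The restriction of an
  infinitary sum to the sequences with length in an initial segment of the ordinals is again
  an infinitary sum.
\<close>

definition ord_rel :: "'o::wellorder \<Rightarrow> 'o rel" where
  "ord_rel \<gamma> = {(\<alpha>, \<beta>). \<alpha> \<le> \<beta> \<and> \<beta> < \<gamma>}"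

definition ord_below_succ :: "'l rel \<Rightarrow> 'o::wellorder \<Rightarrow> bool" where
  "ord_below_succ lam \<gamma> \<longleftrightarrow> ord_rel \<gamma> <o cardSuc lam"

definition limit_ord :: "'o::wellorder \<Rightarrow> bool" where
  "limit_ord \<alpha> \<longleftrightarrow> {..<\<alpha>} \<noteq> {} \<and> (\<forall>\<beta><\<alpha>. \<exists>\<gamma><\<alpha>. \<beta> < \<gamma>)"

text \<open>A sequence is the pair of its length and its entries, the latter being \<^const>\<open>undefined\<close>
  from the length onwards, so that equal sequences are equal pairs.\<close>

type_synonym ('o, 's) ord_seq = "'o \<times> ('o \<Rightarrow> 's)"

definition ord_seqs :: "('o::wellorder, 's) ord_seq set" where
  "ord_seqs = {(\<alpha>, f). f \<in> extensional {..<\<alpha>}}"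

definition mk_seq :: "'o::wellorder \<Rightarrow> ('o \<Rightarrow> 's) \<Rightarrow> ('o, 's) ord_seq" where
  "mk_seq \<alpha> f = (\<alpha>, restrict f {..<\<alpha>})"

abbreviation lh :: "('o::wellorder, 's) ord_seq \<Rightarrow> 'o" where
  "lh s \<equiv> fst s"

definition seq_restrict :: "('o::wellorder, 's) ord_seq \<Rightarrow> 'o \<Rightarrow> ('o, 's) ord_seq" where
  "seq_restrict s \<alpha> = mk_seq \<alpha> (snd s)"


section \<open>Positively totally ordered monoids and infinitary sums\<close>

class pos_tot_ord_monoid = monoid_add + linorder +
  assumes pos_add_mono: "a \<le> b \<Longrightarrow> c \<le> d \<Longrightarrow> a + c \<le> b + d"
    and zero_minimum: "0 \<le> a"
    and nontrivial: "\<exists>a. a \<noteq> 0"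

definition infinitary_sum ::
    "(('o::wellorder, 's::pos_tot_ord_monoid) ord_seq \<rightharpoonup> 's) \<Rightarrow> bool" where
  "infinitary_sum Sm \<longleftrightarrow>
     dom Sm \<subseteq> ord_seqs \<and>
     (\<forall>s\<in>ord_seqs. {..<lh s} = {} \<longrightarrow> Sm s = Some 0) \<and>
     (\<forall>s\<in>dom Sm. finite {..<lh s} \<and> {..<lh s} \<noteq> {} \<longrightarrow>
        Sm s = Some (sum_list (map (snd s) (sorted_list_of_set {..<lh s})))) \<and>
     (\<forall>s\<in>dom Sm. limit_ord (lh s) \<and>
        (\<forall>\<beta><lh s. \<exists>\<alpha>. \<beta> \<le> \<alpha> \<and> \<alpha> < lh s \<and> seq_restrict s \<alpha> \<in> dom Sm) \<longrightarrow>
        isLub UNIV {the (Sm (seq_restrict s \<alpha>)) | \<alpha>. \<alpha> < lh s \<and> seq_restrict s \<alpha> \<in> dom Sm}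
          (the (Sm s)))"


section \<open>Topologies and generated algebras\<close>

definition is_base :: "'y topology \<Rightarrow> 'y set set \<Rightarrow> bool" where
  "is_base T B \<longleftrightarrow>
     (\<forall>U\<in>B. openin T U) \<and> (\<forall>U. openin T U \<longrightarrow> (\<exists>B'\<subseteq>B. U = \<Union>B'))"

text \<open>The least cardinality of a base; it is attained because cardinals are well-ordered.\<close>

definition weight :: "'y topology \<Rightarrow> 'y set rel" where
  "weight T = |SOME B. is_base T B \<and> (\<forall>B'. is_base T B' \<longrightarrow> |B| \<le>o |B'| )|"

definition succ_algebra :: "'l rel \<Rightarrow> 'y set \<Rightarrow> 'y set set \<Rightarrow> bool" where
  "succ_algebra lam Y M \<longleftrightarrow>
     M \<subseteq> Pow Y \<and>
     (\<forall>A\<in>M. Y - A \<in> M) \<and>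
     (\<forall>F\<subseteq>M. |F| \<le>o lam \<longrightarrow> \<Union>F \<in> M \<and> Y \<inter> \<Inter>F \<in> M)"

definition generated_succ_algebra :: "'l rel \<Rightarrow> 'y set \<Rightarrow> 'y set set \<Rightarrow> 'y set set" where
  "generated_succ_algebra lam Y G = succ_algebra lam Y hull G"

definition is_local_basis :: "'y topology \<Rightarrow> 'y \<Rightarrow> 'y set set \<Rightarrow> bool" where
  "is_local_basis T x B \<longleftrightarrow>
     (\<forall>U\<in>B. openin T U \<and> x \<in> U) \<and>
     (\<forall>V. openin T V \<and> x \<in> V \<longrightarrow> (\<exists>U\<in>B. U \<subseteq> V))"


section \<open>Measures\<close>

text \<open>The definition is meant for a \<open>succ_algebra lam (topspace T) M\<close> containing all open sets
  of \<open>T\<close>.\<close>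

definition succ_measure ::
    "'l rel \<Rightarrow> 'y topology \<Rightarrow> 'y set set \<Rightarrow>
     (('o::wellorder, 's::pos_tot_ord_monoid) ord_seq \<rightharpoonup> 's) \<Rightarrow> ('y set \<rightharpoonup> 's) \<Rightarrow> bool" where
  "succ_measure lam T M Sm \<mu> \<longleftrightarrow>
     dom \<mu> \<subseteq> Pow (topspace T) \<and> M \<subseteq> dom \<mu> \<and>
     \<mu> {} = Some 0 \<and>
     the (\<mu> (topspace T)) > 0 \<and>
     (\<forall>A\<in>M. \<forall>B\<in>M. A \<subseteq> B \<longrightarrow> the (\<mu> A) \<le> the (\<mu> B)) \<and>
     (\<forall>(\<gamma>::'o) A. ord_below_succ lam \<gamma> \<and> A ` {..<\<gamma>} \<subseteq> M \<and> disjoint_family_on A {..<\<gamma>} \<longrightarrow>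
        mk_seq \<gamma> (\<lambda>i. the (\<mu> (A i))) \<in> dom Sm \<and>
        \<mu> (\<Union>i<\<gamma>. A i) = Sm (mk_seq \<gamma> (\<lambda>i. the (\<mu> (A i))))) \<and>
     (\<forall>x\<in>topspace T. \<forall>(\<gamma>::'o) A.
        {x} \<in> M \<and> ord_below_succ lam \<gamma> \<and> is_local_basis T x (A ` {..<\<gamma>}) \<longrightarrow>
        isGlb UNIV ((\<lambda>i. the (\<mu> (A i))) ` {..<\<gamma>}) (the (\<mu> {x})))"

definition continuous_succ_measure ::
    "'l rel \<Rightarrow> 'y topology \<Rightarrow> 'y set set \<Rightarrow>
     (('o::wellorder, 's::pos_tot_ord_monoid) ord_seq \<rightharpoonup> 's) \<Rightarrow> ('y set \<rightharpoonup> 's) \<Rightarrow> bool" where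
  "continuous_succ_measure lam T M Sm \<mu> \<longleftrightarrow>
     succ_measure lam T M Sm \<mu> \<and> (\<forall>x\<in>topspace T. {x} \<in> M \<and> \<mu> {x} = Some 0)"

end

theory Submission
  imports Defs "HOL-Library.Countable_Set_Type"
begin

text \<open>
  Suppose \<open>\<mu>\<close> is a continuous measure. An initial segment \<open>I\<close> of the values that is closed under
  sums and least upper bounds pulls back to a family of sets closed under unions of size at most
  \<open>\<lambda>\<close>. If \<open>I\<close> contains a positive value, then the basic open sets with measure in \<open>I\<close> cover
  \<open>Y\<close> by continuity, so \<open>\<mu>(Y) \<in> I\<close>. When \<open>b\<^sub>n\<^sub>+\<^sub>1 + b\<^sub>n\<^sub>+\<^sub>1 \<le> b\<^sub>n\<close> for all \<open>n\<close>, the set of values below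
  every \<open>b\<^sub>n\<close> is such a segment; hence \<open>b\<close> has no positive lower bound if \<open>b\<^sub>0 < \<mu>(Y)\<close>.
  Repeatedly splitting a set and keeping the smaller half yields such a \<open>b\<close> with positive entries.
  Doing the same with an infinite disjoint family shows that, inside a set \<open>A\<close> with
  \<open>\<mu>(A) < \<mu>(Y)\<close>, the measures of its members cannot be bounded away from \<open>0\<close>, so disjoint
  families of positive subsets of \<open>A\<close> are countable. As for a real-valued measure, \<open>A\<close> is then,
  up to null sets, a union of \<open>2\<^sup>\<omega> \<le> \<lambda>\<close> null sets, hence null. But \<open>Y\<close> is covered by at most
  \<open>\<lambda>\<close> such sets \<open>A\<close>.
\<close>

section \<open>Absorbing sets of values\<close>

text \<open>The clauses for \<open>0\<close>, \<open>+\<close> and least upper bounds serve the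
  zero, successor and limit cases of \<open>measure_UN_absorb\<close>; downward closure lets sets be
  replaced by disjoint pieces.\<close>

definition absorbing :: "'s::pos_tot_ord_monoid set \<Rightarrow> bool" where
  "absorbing I \<longleftrightarrow> 0 \<in> I \<and> (\<forall>y\<in>I. \<forall>x\<le>y. x \<in> I) \<and> (\<forall>x\<in>I. \<forall>y\<in>I. x + y \<in> I) \<and>
     (\<forall>X u. X \<subseteq> I \<and> isLub UNIV X u \<longrightarrow> u \<in> I)"

definition halving :: "(nat \<Rightarrow> 's::pos_tot_ord_monoid) \<Rightarrow> bool" where
  "halving b \<longleftrightarrow> (\<forall>n. b (Suc n) + b (Suc n) \<le> b n)"

lemma pos_iff_neq_0: "0 < x \<longleftrightarrow> x \<noteq> 0" for x :: "'s::pos_tot_ord_monoid"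
  using zero_minimum[of x] by auto

lemma le_0_iff: "x \<le> 0 \<longleftrightarrow> x = 0" for x :: "'s::pos_tot_ord_monoid"
  using zero_minimum[of x] by auto

lemma isLub_bound: "isLub UNIV X u \<Longrightarrow> (\<And>x. x \<in> X \<Longrightarrow> x \<le> c) \<Longrightarrow> u \<le> c"
  by (rule isLub_le_isUb) (auto intro: isUbI setleI)

lemma absorbing_0: "absorbing {0 :: 's::pos_tot_ord_monoid}"
proof -
  have "u = 0" if "X \<subseteq> {0}" "isLub UNIV X u" for X and u :: 's
    using isLub_bound[OF that(2), of 0] that(1) by (auto simp: le_0_iff)
  then show ?thesis
    unfolding absorbing_def by (auto simp: le_0_iff)
qed

text \<open>Shifting the index absorbs sums: if x and y are at most \<open>b (Suc n)\<close>, then x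
  + y is at most \<open>b n\<close>.\<close>

lemma absorbing_halving:
  fixes b :: "nat \<Rightarrow> 's::pos_tot_ord_monoid"
  assumes "halving b"
  shows "absorbing {x. \<forall>n. x \<le> b n}"
proof -
  have "x + y \<le> b n" if "\<forall>n. x \<le> b n" "\<forall>n. y \<le> b n" for x y n
  proof -
    have "x + y \<le> b (Suc n) + b (Suc n)"
      using that by (intro pos_add_mono) auto
    also have "\<dots> \<le> b n"
      using assms by (simp add: halving_def)
    finally show ?thesis .
  qed
  moreover have "u \<le> b n" if "X \<subseteq> {x. \<forall>n. x \<le> b n}" "isLub UNIV X u" for X u n
    using that by (intro isLub_bound[of X u]) auto
  ultimately show ?thesis
    unfolding absorbing_def by (auto simp: zero_minimum intro: order_trans)
qed


section \<open>Absorbing measures\<close>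

locale infinite_succ_algebra =
  fixes lam :: "'l rel" and Y :: "'y set" and M :: "'y set set"
  assumes alg: "succ_algebra lam Y M" and infinite: "natLeq \<le>o lam"
begin

lemma countable_le: "countable F \<Longrightarrow> |F| \<le>o lam" for F :: "'b set"
  using infinite ordLeq_transitive unfolding countable_card_le_natLeq by blast

lemma M_subset: "A \<in> M \<Longrightarrow> A \<subseteq> Y"
  using alg by (auto simp: succ_algebra_def)

lemma M_Union: "F \<subseteq> M \<Longrightarrow> |F| \<le>o lam \<Longrightarrow> \<Union>F \<in> M"
  using alg by (auto simp: succ_algebra_def)

lemma M_Inter: "F \<subseteq> M \<Longrightarrow> |F| \<le>o lam \<Longrightarrow> F \<noteq> {} \<Longrightarrow> \<Inter>F \<in> M"
proof -
  assume F: "F \<subseteq> M" "|F| \<le>o lam" "F \<noteq> {}"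
  then have "Y \<inter> \<Inter>F = \<Inter>F"
    using M_subset by blast
  then show ?thesis
    using alg F by (metis succ_algebra_def)
qed

lemma M_Int: "A \<in> M \<Longrightarrow> B \<in> M \<Longrightarrow> A \<inter> B \<in> M"
  using M_Inter[of "{A, B}"] countable_le[of "{A, B}"] by simp

lemma M_Diff: "A \<in> M \<Longrightarrow> B \<in> M \<Longrightarrow> A - B \<in> M"
proof -
  assume AB: "A \<in> M" "B \<in> M"
  then have "A - B = A \<inter> (Y - B)"
    using M_subset by blast
  then show ?thesis
    using alg AB M_Int by (metis succ_algebra_def)
qed

lemma M_empty: "{} \<in> M"
  using M_Union[of "{}"] countable_le[of "{}"] by simp

lemma M_space: "Y \<in> M"
  using alg M_empty by (metis Diff_empty succ_algebra_def)

end

text \<open>Isolates what the core argument needs: \<open>m_absorb\<close> stands in for infinite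
  additivity, and \<open>small_cover\<close> is the form in which continuity enters. Neither ordinal
  sequences nor a topology occur here.\<close>

locale absorbing_measure = infinite_succ_algebra lam Y M
  for lam :: "'l rel" and Y :: "'y set" and M :: "'y set set" +
  fixes m :: "'y set \<Rightarrow> 's::pos_tot_ord_monoid"
  assumes continuum_le: "|UNIV :: (nat \<Rightarrow> nat) set| \<le>o lam"
    and m_empty: "m {} = 0"
    and m_mono: "A \<in> M \<Longrightarrow> B \<in> M \<Longrightarrow> A \<subseteq> B \<Longrightarrow> m A \<le> m B"
    and m_Un: "A \<in> M \<Longrightarrow> B \<in> M \<Longrightarrow> A \<inter> B = {} \<Longrightarrow> m (A \<union> B) = m A + m B"
    and m_absorb: "absorbing I \<Longrightarrow> F \<subseteq> M \<Longrightarrow> |F| \<le>o lam \<Longrightarrow> (\<And>A. A \<in> F \<Longrightarrow> m A \<in> I) \<Longrightarrow>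
                     m (\<Union>F) \<in> I"
    and small_cover: "0 < r \<Longrightarrow> \<exists>F\<subseteq>M. |F| \<le>o lam \<and> \<Union>F = Y \<and> (\<forall>A\<in>F. m A < r)"
begin

section \<open>Halving sequences and small positive values\<close>

lemma null_Union:
  assumes "F \<subseteq> M" "|F| \<le>o lam" "\<And>A. A \<in> F \<Longrightarrow> m A = 0"
  shows "m (\<Union>F) = 0"
  using m_absorb[OF absorbing_0 assms(1,2)] assms(3) by simp

text \<open>Every member of a cover by sets of measure below \<open>r\<close> has measure below all
  \<open>b n\<close>. The values at most every \<open>b n\<close> form an absorbing set, so
  \<open>m Y\<close> is one of them.\<close>

lemma halving_lower_bound:
  assumes "halving b" "0 < r" "\<And>n. r \<le> b n"
  shows "m Y \<le> b 0"
proof -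
  obtain F where F: "F \<subseteq> M" "|F| \<le>o lam" "\<Union>F = Y" "\<forall>A\<in>F. m A < r"
    using small_cover[OF assms(2)] by blast
  have "m (\<Union>F) \<in> {x. \<forall>n. x \<le> b n}"
    using assms(3) F(4) by (intro m_absorb absorbing_halving assms(1) F) (auto intro: less_le_trans less_imp_le)
  then show ?thesis
    using F(3) by simp
qed

text \<open>A cover of \<open>Y\<close> by sets of measure below \<open>r\<close> cuts
  \<open>A\<close> into at most \<open>lam\<close> pieces; they cannot all be null, since then
  \<open>A\<close> would be.\<close>

lemma small_positive_subset:
  assumes A: "A \<in> M" "0 < m A" and "0 < r"
  obtains B where "B \<in> M" "B \<subseteq> A" "0 < m B" "m B < r"
proof -
  obtain F where F: "F \<subseteq> M" "|F| \<le>o lam" "\<Union>F = Y" "\<forall>B\<in>F. m B < r"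
    using small_cover[OF assms(3)] by blast
  let ?G = "(\<inter>) A ` F"
  have "\<exists>C\<in>?G. m C \<noteq> 0"
  proof (rule ccontr)
    assume "\<not> ?thesis"
    moreover have "|?G| \<le>o lam"
      using F(2) card_of_image ordLeq_transitive by blast
    ultimately have "m (\<Union>?G) = 0"
      using F(1) A(1) M_Int by (intro null_Union) auto
    moreover have "\<Union>?G = A"
      using F(3) M_subset[OF A(1)] by auto
    ultimately show False
      using A(2) by simp
  qed
  then obtain B where B: "B \<in> F" "m (A \<inter> B) \<noteq> 0"
    by blast
  have "m (A \<inter> B) \<le> m B"
    using A B F(1) by (intro m_mono M_Int) auto
  then have "m (A \<inter> B) < r"
    using F(4) B(1) by (meson le_less_trans)
  then show ?thesis
    using that[of "A \<inter> B"] A B F(1) M_Int by (auto simp: pos_iff_neq_0)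
qed

lemma halve_positive:
  assumes A: "A \<in> M" "0 < m A"
  obtains B where "B \<in> M" "B \<subseteq> A" "0 < m B" "m B + m B \<le> m A"
proof -
  obtain B where B: "B \<in> M" "B \<subseteq> A" "0 < m B" "m B < m A"
    using small_positive_subset[OF A A(2)] .
  have C: "A - B \<in> M"
    using A B M_Diff by blast
  have eq: "m A = m B + m (A - B)"
    using m_Un[OF B(1) C] B(2) by (simp add: Un_absorb1)
  \<comment> \<open>If \<open>m (A - B)\<close> were \<open>0\<close>, then
    \<open>m A = m B\<close>, against the choice of \<open>B\<close>. The smaller of the two
    positive pieces is kept.\<close>
  then have pos: "0 < m (A - B)"
    using B(4) by (auto simp: pos_iff_neq_0)
  show ?thesis
  proof (cases "m B \<le> m (A - B)")
    case True
    then show ?thesis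
      using that[OF B(1-3)] eq pos_add_mono[of "m B" "m B"] by simp
  next
    case False
    then show ?thesis
      using that[OF C _ pos] eq pos_add_mono[of "m (A - B)" "m B" "m (A - B)" "m (A - B)"] by simp
  qed
qed

text \<open>Halving is iterated from a set \<open>A0\<close> of measure less than
  \<open>m Y\<close>: a positive lower bound of the values would give \<open>m Y \<le> m A0\<close>
  by \<open>halving_lower_bound\<close>.\<close>

lemma obtain_null_sequence:
  assumes "0 < m Y"
  obtains b :: "nat \<Rightarrow> 's" where "\<And>n. 0 < b n" "\<And>r. 0 < r \<Longrightarrow> \<exists>n. b n < r"
proof -
  obtain A0 where A0: "A0 \<in> M" "0 < m A0" "m A0 < m Y"
    using small_positive_subset[OF M_space assms assms] .
  \<comment> \<open>The clause on \<open>n = 0\<close> makes dependent choice start at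
    \<open>A0\<close>.\<close>
  have "\<exists>A. \<forall>n. (A n \<in> M \<and> 0 < m (A n) \<and> (n = 0 \<longrightarrow> A n = A0)) \<and>
          m (A (Suc n)) + m (A (Suc n)) \<le> m (A n)"
  proof (rule dependent_nat_choice)
    show "\<exists>A. A \<in> M \<and> 0 < m A \<and> (0 = (0::nat) \<longrightarrow> A = A0)"
      using A0 by blast
  next
    fix A and n :: nat
    assume "A \<in> M \<and> 0 < m A \<and> (n = 0 \<longrightarrow> A = A0)"
    then show "\<exists>B. (B \<in> M \<and> 0 < m B \<and> (Suc n = 0 \<longrightarrow> B = A0)) \<and> m B + m B \<le> m A"
      using halve_positive[of A] by (metis nat.distinct(1))
  qed
  then obtain A where A: "\<And>n. 0 < m (A n)" "A 0 = A0"
      "\<And>n. m (A (Suc n)) + m (A (Suc n)) \<le> m (A n)"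
    by blast
  have "halving (\<lambda>n. m (A n))"
    using A(3) by (simp add: halving_def)
  then have "\<exists>n. m (A n) < r" if "0 < r" for r
    using halving_lower_bound[OF _ that, of "\<lambda>n. m (A n)"] A(2) A0(3) by (metis not_le)
  then show ?thesis
    using that[of "\<lambda>n. m (A n)"] A(1) by blast
qed

section \<open>Countability of disjoint families of positive sets\<close>

lemma halve_infinite_family:
  assumes Z: "Z \<subseteq> M" "countable Z" "infinite Z" "disjoint Z"
  obtains Z' where "Z' \<subseteq> Z" "infinite Z'" "m (\<Union>Z') + m (\<Union>Z') \<le> m (\<Union>Z)"
proof -
  obtain f :: "nat \<Rightarrow> 'y set" where f: "inj f" "range f \<subseteq> Z"
    using infinite_countable_subset[OF Z(3)] by metis
  \<comment> \<open>The images of the even and of the odd numbers keep both parts infinite;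
    \<open>Z2\<close> takes all the rest, so that the two parts exhaust \<open>Z\<close>.\<close>
  define Z1 where "Z1 = f ` {n. even n}"
  define Z2 where "Z2 = Z - Z1"
  have inf1: "infinite Z1"
  proof -
    have "infinite (range (\<lambda>n::nat. 2 * n))"
      by (intro range_inj_infinite) (simp add: inj_def)
    then have "infinite {n::nat. even n}"
      by (rule infinite_super[rotated]) auto
    then show ?thesis
      using f(1) unfolding Z1_def by (meson finite_imageD inj_on_subset subset_UNIV)
  qed
  have "f ` {n. odd n} \<subseteq> Z2"
    using f by (auto simp: Z1_def Z2_def inj_on_def)
  moreover have "infinite (f ` {n. odd n})"
  proof -
    have "infinite (range (\<lambda>n::nat. 2 * n + 1))"
      by (intro range_inj_infinite) (simp add: inj_def)
    then have "infinite {n::nat. odd n}"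
      by (rule infinite_super[rotated]) auto
    then show ?thesis
      using f(1) by (meson finite_imageD inj_on_subset subset_UNIV)
  qed
  ultimately have inf2: "infinite Z2"
    using infinite_super by blast
  have sub: "Z1 \<subseteq> Z" "Z2 \<subseteq> Z"
    using f(2) by (auto simp: Z1_def Z2_def)
  have inM: "\<Union>Z1 \<in> M" "\<Union>Z2 \<in> M"
    using sub Z(1,2) countable_le countable_subset by (blast intro: M_Union)+
  have "\<Union>Z1 \<inter> \<Union>Z2 = {}"
    using Z(4) sub by (fastforce simp: Z2_def disjoint_def)
  moreover have "\<Union>Z1 \<union> \<Union>Z2 = \<Union>Z"
    using sub by (auto simp: Z2_def)
  ultimately have eq: "m (\<Union>Z) = m (\<Union>Z1) + m (\<Union>Z2)"
    using m_Un[OF inM] by simp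
  show ?thesis
  proof (cases "m (\<Union>Z1) \<le> m (\<Union>Z2)")
    case True
    then show ?thesis
      using that[OF sub(1) inf1] eq pos_add_mono[of "m (\<Union>Z1)" "m (\<Union>Z1)"] by simp
  next
    case False
    then show ?thesis
      using that[OF sub(2) inf2] eq
        pos_add_mono[of "m (\<Union>Z2)" "m (\<Union>Z1)" "m (\<Union>Z2)" "m (\<Union>Z2)"] by simp
  qed
qed

text \<open>An infinite family could be halved again and again into infinite subfamilies. Each is
  nonempty, so its union has measure at least \<open>r\<close>, and
  \<open>halving_lower_bound\<close> yields \<open>m Y \<le> m A\<close>.\<close>

lemma finite_disjoint_bounded_below:
  assumes A: "A \<in> M" "m A < m Y" and F: "F \<subseteq> M" "disjoint F" "\<Union>F \<subseteq> A"
    and r: "0 < r" "\<And>B. B \<in> F \<Longrightarrow> r \<le> m B"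
  shows "finite F"
proof (rule ccontr)
  assume "infinite F"
  \<comment> \<open>Passing to a countable subfamily ensures that the unions lie in
    \<open>M\<close>.\<close>
  then obtain Z0 where Z0: "Z0 \<subseteq> F" "countable Z0" "infinite Z0"
    by (metis infinite_countable_subset')
  have "\<exists>Z. \<forall>n. (Z n \<subseteq> Z0 \<and> infinite (Z n)) \<and>
          m (\<Union>(Z (Suc n))) + m (\<Union>(Z (Suc n))) \<le> m (\<Union>(Z n))"
  proof (rule dependent_nat_choice)
    show "\<exists>Z. Z \<subseteq> Z0 \<and> infinite Z"
      using Z0 by blast
  next
    fix Z and n :: nat
    assume Z: "Z \<subseteq> Z0 \<and> infinite Z"
    have "Z \<subseteq> M" "countable Z"
      using Z Z0 F(1) countable_subset by auto
    moreover have "disjoint Z"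
      using Z Z0(1) F(2) unfolding disjoint_def by blast
    ultimately obtain Z' where "Z' \<subseteq> Z" "infinite Z'" "m (\<Union>Z') + m (\<Union>Z') \<le> m (\<Union>Z)"
      using Z halve_infinite_family by metis
    then show "\<exists>Z'. (Z' \<subseteq> Z0 \<and> infinite Z') \<and> m (\<Union>Z') + m (\<Union>Z') \<le> m (\<Union>Z)"
      using Z by blast
  qed
  then obtain Z where Z: "\<And>n. Z n \<subseteq> Z0" "\<And>n. infinite (Z n)"
      "\<And>n. m (\<Union>(Z (Suc n))) + m (\<Union>(Z (Suc n))) \<le> m (\<Union>(Z n))"
    by blast
  have inM: "\<Union>(Z n) \<in> M" for n
    using order_trans[OF Z(1)[of n] Z0(1)] F(1) countable_subset[OF Z(1)[of n] Z0(2)]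
    by (intro M_Union countable_le) auto
  have "r \<le> m (\<Union>(Z n))" for n
  proof -
    obtain B where B: "B \<in> Z n"
      using Z(2)[of n] by (metis ex_in_conv finite.emptyI)
    then have "B \<in> F"
      using Z(1) Z0(1) by blast
    have "r \<le> m B"
      using r(2) \<open>B \<in> F\<close> .
    also have "m B \<le> m (\<Union>(Z n))"
      using B \<open>B \<in> F\<close> F(1) inM by (intro m_mono) auto
    finally show ?thesis .
  qed
  moreover have "halving (\<lambda>n. m (\<Union>(Z n)))"
    using Z(3) by (simp add: halving_def)
  ultimately have "m Y \<le> m (\<Union>(Z 0))"
    using halving_lower_bound r(1) by metis
  also have "\<dots> \<le> m A"
    using Z(1)[of 0] Z0(1) F(3) by (intro m_mono inM A(1)) blast
  finally show False
    using A(2) by simp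
qed

text \<open>\<open>F\<close> is the union over n of its members of measure at least
  \<open>b n\<close>, which are finitely many for each n.\<close>

lemma countable_disjoint_positive:
  assumes A: "A \<in> M" "m A < m Y" and F: "F \<subseteq> M" "disjoint F" "\<Union>F \<subseteq> A"
    and pos: "\<And>B. B \<in> F \<Longrightarrow> 0 < m B"
  shows "countable F"
proof -
  have "0 < m Y"
    using A(2) zero_minimum[of "m A"] by (rule le_less_trans[rotated])
  then obtain b :: "nat \<Rightarrow> 's" where b: "\<And>n. 0 < b n" "\<And>r. 0 < r \<Longrightarrow> \<exists>n. b n < r"
    using obtain_null_sequence by metis
  have fin: "finite {B \<in> F. b n \<le> m B}" for n
    using F b(1) by (intro finite_disjoint_bounded_below[OF A]) (auto simp: disjoint_def)
  have "F \<subseteq> (\<Union>n. {B \<in> F. b n \<le> m B})"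
    using b(2) pos by (fastforce dest: less_imp_le)
  then show ?thesis
    by (rule countable_subset) (intro countable_UN countable_finite[OF fin], simp)
qed

text \<open>\<open>C\<close> is a maximal disjoint family of positive subsets of \<open>A\<close> of
  measure below \<open>r\<close>. It is countable, and a remainder of positive measure would contain
  a further member.\<close>

lemma almost_cover_small:
  assumes A: "A \<in> M" "m A < m Y" and r: "0 < r"
  obtains C where "countable C" "C \<subseteq> M" "\<And>B. B \<in> C \<Longrightarrow> m B < r" "m (A - \<Union>C) = 0"
proof -
  define P where "P = {C. C \<subseteq> {B \<in> M. B \<subseteq> A \<and> 0 < m B \<and> m B < r} \<and> disjoint C}"
  have "\<Union>K \<in> P" if K: "subset.chain P K" for K
  proof -
    have "disjoint (\<Union>K)"
    proof (rule disjointI)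
      fix B B' assume "B \<in> \<Union>K" "B' \<in> \<Union>K" "B \<noteq> B'"
      then obtain C where "C \<in> K" "B \<in> C" "B' \<in> C"
        using K unfolding subset_chain_def by blast
      then show "B \<inter> B' = {}"
        using K \<open>B \<noteq> B'\<close> unfolding subset_chain_def P_def disjoint_def by blast
    qed
    then show ?thesis
      using K unfolding subset_chain_def P_def by blast
  qed
  then obtain C where C: "C \<in> P" "\<And>X. X \<in> P \<Longrightarrow> C \<subseteq> X \<Longrightarrow> X = C"
    using subset_Zorn'[of P] by blast
  have cnt: "countable C"
    using C(1) by (intro countable_disjoint_positive[OF A]) (auto simp: P_def)
  have CM: "C \<subseteq> M"
    using C(1) by (auto simp: P_def)
  have R: "A - \<Union>C \<in> M"
    using A(1) cnt CM by (intro M_Diff M_Union countable_le)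
  have "m (A - \<Union>C) = 0"
  proof (rule ccontr)
    assume "m (A - \<Union>C) \<noteq> 0"
    then obtain B where B: "B \<in> M" "B \<subseteq> A - \<Union>C" "0 < m B" "m B < r"
      using small_positive_subset[OF R _ r] by (metis pos_iff_neq_0)
    have "insert B C \<in> P"
      using C(1) B unfolding P_def by (auto simp: disjoint_def)
    then have "B \<in> C"
      using C(2)[of "insert B C"] by blast
    then have "B = {}"
      using B(2) by blast
    then show False
      using B(3) m_empty by simp
  qed
  then show ?thesis
    using that[OF cnt CM] C(1) by (auto simp: P_def)
qed

text \<open>Up to null sets, \<open>A\<close> is the union of continuum many sets \<open>\<Inter>n. C n (f n)\<close>, each of which is
  null because \<open>m (C n k)\<close> tends to \<open>0\<close> as \<open>n\<close> grows.\<close>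

lemma null_of_less_total:
  assumes A: "A \<in> M" "m A < m Y"
  shows "m A = 0"
proof -
  have "0 < m Y"
    using A(2) zero_minimum[of "m A"] by (rule le_less_trans[rotated])
  then obtain b :: "nat \<Rightarrow> 's" where b: "\<And>n. 0 < b n" "\<And>r. 0 < r \<Longrightarrow> \<exists>n. b n < r"
    using obtain_null_sequence by metis
  have "\<forall>n. \<exists>C. countable C \<and> C \<subseteq> M \<and> (\<forall>B\<in>C. m B < b n) \<and> m (A - \<Union>C) = 0"
    using almost_cover_small[OF A b(1)] by metis
  then obtain C where C: "\<And>n. countable (C n)" "\<And>n. C n \<subseteq> M"
      "\<And>n B. B \<in> C n \<Longrightarrow> m B < b n" "\<And>n. m (A - \<Union>(C n)) = 0"
    by metis
  show ?thesis
  proof (cases "\<exists>n. C n = {}")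
    case True
    then obtain n where "C n = {}"
      by blast
    then show ?thesis
      using C(4)[of n] by simp
  next
    case False
    define g where "g f = (\<Inter>n. from_nat_into (C n) (f n))" for f :: "nat \<Rightarrow> nat"
    define N where "N = range (\<lambda>n. A - \<Union>(C n))"
    have in_C: "from_nat_into (C n) k \<in> C n" for n k
      using False by (simp add: from_nat_into)
    have gM: "g f \<in> M" for f
      unfolding g_def using in_C C(2) by (intro M_Inter countable_le) auto
    have g0: "m (g f) = 0" for f
    proof (rule ccontr)
      assume "m (g f) \<noteq> 0"
      then obtain n where "b n < m (g f)"
        using b(2) pos_iff_neq_0 by metis
      also have "m (g f) \<le> m (from_nat_into (C n) (f n))"
        using in_C C(2) by (intro m_mono gM) (auto simp: g_def)
      also have "\<dots> < b n"
        using in_C C(3) by blast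
      finally show False .
    qed
    have NM: "N \<subseteq> M"
      unfolding N_def using A(1) C(1,2) by (auto intro!: M_Diff M_Union countable_le)
    have rg: "|range g| \<le>o lam"
      using card_of_image continuum_le ordLeq_transitive by blast
    have gU: "\<Union>(range g) \<in> M"
      using rg gM by (intro M_Union) auto
    have NU: "\<Union>N \<in> M"
      using NM by (intro M_Union countable_le) (simp_all add: N_def)
    have "m (\<Union>(range g)) = 0"
      using rg gM g0 by (intro null_Union) auto
    moreover have "m (\<Union>N) = 0"
      using NM C(4) by (intro null_Union countable_le) (auto simp: N_def)
    ultimately have null: "m (\<Union>{\<Union>(range g), \<Union>N}) = 0"
      using gU NU by (intro null_Union countable_le) auto
    have "A \<subseteq> \<Union>{\<Union>(range g), \<Union>N}"
    proof
      fix x assume "x \<in> A"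
      show "x \<in> \<Union>{\<Union>(range g), \<Union>N}"
      proof (cases "\<exists>n. x \<notin> \<Union>(C n)")
        case True
        then show ?thesis
          using \<open>x \<in> A\<close> by (auto simp: N_def)
      next
        case False
        then have "\<forall>n. \<exists>k. x \<in> from_nat_into (C n) k"
          using C(1) by (metis UnionE from_nat_into_surj)
        then obtain f where "\<And>n. x \<in> from_nat_into (C n) (f n)"
          by metis
        then have "x \<in> g f"
          by (simp add: g_def)
        then show ?thesis
          by blast
      qed
    qed
    then have "m A \<le> m (\<Union>{\<Union>(range g), \<Union>N})"
      using gU NU A(1) by (intro m_mono M_Union countable_le) auto
    then show ?thesis
      using null by (simp add: le_0_iff)
  qed
qed

lemma total_null: "m Y = 0"
proof (rule ccontr)
  assume "m Y \<noteq> 0"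
  then have pos: "0 < m Y"
    by (simp add: pos_iff_neq_0)
  obtain B where "B \<in> M" "0 < m B" "m B < m Y"
    using small_positive_subset[OF M_space pos pos] .
  then show False
    using null_of_less_total by fastforce
qed

end


section \<open>Ordinals and cardinals\<close>

lemma Well_order_le: "Well_order {(x :: 'o::wellorder, y). x \<le> y}"
  and Field_le: "Field {(x :: 'o::wellorder, y). x \<le> y} = UNIV"
proof -
  let ?r = "{(x :: 'o, y). x \<le> y}"
  show F: "Field ?r = UNIV"
    by (auto simp: Field_def)
  have "?r - Id = {(x, y). x < y}"
    by auto
  then have "wf (?r - Id)"
    using wf by simp
  then show "Well_order ?r"
    unfolding F order_on_defs
    by (auto simp: refl_on_def trans_def antisym_def total_on_def)
qed

lemma ord_rel_Restr: "ord_rel \<gamma> = Restr {(x, y). x \<le> y} (underS {(x, y). x \<le> y} \<gamma>)"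
  by (auto simp: ord_rel_def underS_def)

lemma Well_order_ord_rel: "Well_order (ord_rel \<gamma>)"
  unfolding ord_rel_Restr by (intro Well_order_Restr Well_order_le)

lemma Field_ord_rel: "Field (ord_rel \<gamma>) = {..<\<gamma>}"
  by (auto simp: ord_rel_def Field_def)

text \<open>A cardinal below that of the type is below the order of the type, hence isomorphic to a
  proper initial segment, which is some \<open>ord_rel \<gamma>\<close>.\<close>

lemma enumerate_by_ordinal:
  fixes F :: "'a set"
  assumes "|F| <o |UNIV :: 'o::wellorder set|"
  obtains \<gamma> :: "'o::wellorder" and f where "bij_betw f {..<\<gamma>} F"
proof -
  have "|UNIV :: 'o set| \<le>o {(x :: 'o, y). x \<le> y}"
    using Well_order_le unfolding Field_le by (rule card_of_least)
  with assms have "|F| <o {(x :: 'o, y). x \<le> y}"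
    by (rule ordLess_ordLeq_trans)
  then obtain \<gamma> :: 'o where "|F| =o ord_rel \<gamma>"
    unfolding ord_rel_Restr using ordLess_iff_ordIso_Restr[OF Well_order_le card_of_Well_order] by blast
  then have "ord_rel \<gamma> =o |F|"
    by (rule ordIso_symmetric)
  then obtain f where "iso (ord_rel \<gamma>) |F| f"
    unfolding ordIso_def by blast
  then have "bij_betw f {..<\<gamma>} F"
    by (simp add: iso_def Field_ord_rel Field_card_of)
  then show ?thesis
    by (rule that)
qed

text \<open>Otherwise the successor cardinal would embed into \<open>ord_rel \<gamma>\<close>, whose
  field has at most \<open>lam\<close> elements.\<close>

lemma ord_below_succI:
  fixes \<gamma> :: "'o::wellorder"
  assumes "Card_order lam" "|{..<\<gamma>}| \<le>o lam"
  shows "ord_below_succ lam \<gamma>"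
proof (rule ccontr)
  assume "\<not> ?thesis"
  then have "cardSuc lam \<le>o ord_rel \<gamma>"
    unfolding ord_below_succ_def
    using not_ordLess_iff_ordLeq[OF _ Well_order_ord_rel] cardSuc_Card_order[OF assms(1)]
      card_order_on_well_order_on by blast
  then have "|Field (cardSuc lam)| \<le>o |{..<\<gamma>}|"
    using card_of_mono2 by (fastforce simp: Field_ord_rel)
  then have "|Field (cardSuc lam)| \<le>o lam"
    using assms(2) by (rule ordLeq_transitive)
  then have "cardSuc lam \<le>o lam"
    using card_of_Field_ordIso[OF cardSuc_Card_order[OF assms(1)]] ordIso_symmetric
      ordIso_ordLeq_trans by blast
  then show False
    using cardSuc_greater[OF assms(1)] not_ordLess_ordLeq by blast
qed

lemma ordinal_two:
  assumes "infinite (UNIV :: 'o::wellorder set)"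
  obtains z e t :: "'o::wellorder" where "z < e" "{..<t} = {z, e}"
proof -
  have ex: "\<exists>x. x \<notin> X" if "finite X" for X :: "'o set"
    using assms that by (metis UNIV_eq_I)
  define z :: 'o where "z = (LEAST x. x \<notin> {})"
  define e :: 'o where "e = (LEAST x. x \<notin> {z})"
  define t :: 'o where "t = (LEAST x. x \<notin> {z, e})"
  have z: "z \<le> x" for x
    unfolding z_def by (rule Least_le) simp
  have e: "e \<notin> {z}" "\<And>x. x \<notin> {z} \<Longrightarrow> e \<le> x"
    unfolding e_def using LeastI_ex[OF ex[of "{z}"]] by (simp, blast intro: Least_le)
  have t: "t \<notin> {z, e}" "\<And>x. x \<notin> {z, e} \<Longrightarrow> t \<le> x"
    unfolding t_def using LeastI_ex[OF ex[of "{z, e}"]] by (simp, blast intro: Least_le)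
  have "z < e"
    using z[of e] e(1) by auto
  moreover have "e < t" "z < t"
    using e(2)[of t] t(1) z[of t] by auto
  moreover have "x \<in> {z, e}" if "x < t" for x
    using t(2)[of x] that by (meson leD)
  ultimately show ?thesis
    using that[of z e t] by auto
qed

text \<open>As \<omega> is below \<open>lam\<close>, two to the power \<omega> is at most
  \<open>lam\<close>; a function on the naturals is coded by its graph, a subset of a countable
  set.\<close>

lemma continuum_le_of_powers_below:
  assumes lam: "Card_order lam" "is_card_sup (powers_below lam) lam" "natLeq <o lam"
  shows "|UNIV :: (nat \<Rightarrow> nat) set| \<le>o lam"
proof -
  have "|UNIV :: nat set| \<le>o |Field lam|"
    using card_of_nat ordLess_imp_ordLeq[OF lam(3)] card_of_Field_ordIso[OF lam(1)]
    by (meson ordIso_ordLeq_trans ordIso_symmetric ordLeq_ordIso_trans)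
  then obtain f :: "nat \<Rightarrow> 'a" where f: "inj f"
    unfolding card_of_ordLeq[symmetric] by blast
  \<comment> \<open>\<open>powers_below\<close> admits only cardinals on the type of
    \<open>lam\<close>, so \<omega> is represented by the range of \<open>f\<close>.\<close>
  define \<theta> where "\<theta> = |range f|"
  have "\<theta> =o natLeq"
  proof -
    have "|UNIV :: nat set| =o \<theta>"
      unfolding \<theta>_def card_of_ordIso[symmetric] using inj_on_imp_bij_betw[OF f] by blast
    then show ?thesis
      using card_of_nat ordIso_symmetric ordIso_transitive by blast
  qed
  then have "\<theta> <o lam"
    using lam(3) ordIso_ordLess_trans by blast
  then have "ctwo ^c \<theta> \<in> powers_below lam"
    unfolding powers_below_def \<theta>_def using card_of_Card_order by blast
  then have "ctwo ^c \<theta> \<le>o lam"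
    using lam(2) by (simp add: is_card_sup_def)
  moreover have "|UNIV :: (nat \<Rightarrow> nat) set| \<le>o ctwo ^c \<theta>"
  proof -
    \<comment> \<open>\<open>G g\<close> is the characteristic function of the graph of
      \<open>g\<close>, transported along \<open>prod_encode\<close> and \<open>f\<close>; outside
      \<open>range f\<close> it is \<open>undefined\<close>, as \<open>Func\<close>
      requires.\<close>
    define G where "G g y = (if y \<in> range f
        then (case prod_decode (inv f y) of (a, b) \<Rightarrow> g a = b) else undefined)"
      for g :: "nat \<Rightarrow> nat" and y
    have G: "G g (f (prod_encode (a, b))) \<longleftrightarrow> g a = b" for g a b
      using f by (simp add: G_def)
    have "inj G"
    proof (rule injI, rule ext)
      fix g h a assume "G g = G h"
      then have "G h (f (prod_encode (a, g a)))"
        using G by metis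
      then show "g a = h a"
        by (simp add: G)
    qed
    moreover have "range G \<subseteq> Func (range f) UNIV"
      by (auto simp: Func_def G_def)
    ultimately show ?thesis
      unfolding cexp_def ctwo_def \<theta>_def Field_card_of card_of_ordLeq[symmetric] by blast
  qed
  ultimately show ?thesis
    using ordLeq_transitive by blast
qed


section \<open>Measures along the ordinals\<close>

text \<open>\<open>weight\<close> is defined by choice, so a base of least cardinality must be shown
  to exist: the open sets form a base, and cardinals are well-ordered.\<close>

lemma weight_base:
  assumes "weight T \<le>o lam"
  obtains B where "is_base T B" "|B| \<le>o lam"
proof -
  let ?R = "{|B| | B. is_base T B}"
  have "is_base T {U. openin T U}"
    unfolding is_base_def by (auto intro: exI[of _ "{_}"])
  then have "\<exists>r\<in>?R. \<forall>r'\<in>?R. r \<le>o r'"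
    by (intro exists_minim_Card_order) (auto simp: card_of_Card_order)
  then have "\<exists>B. is_base T B \<and> (\<forall>B'. is_base T B' \<longrightarrow> |B| \<le>o |B'| )"
    by blast
  then have "is_base T (SOME B. is_base T B \<and> (\<forall>B'. is_base T B' \<longrightarrow> |B| \<le>o |B'| ))"
    by (rule someI2_ex) blast
  then show ?thesis
    using that assms unfolding weight_def by blast
qed

lemma infinitary_sum_finite:
  assumes "infinitary_sum Sm" "s \<in> dom Sm" "finite {..<lh s}" "{..<lh s} \<noteq> {}"
  shows "Sm s = Some (sum_list (map (snd s) (sorted_list_of_set {..<lh s})))"
  using assms unfolding infinitary_sum_def by simp

lemma infinitary_sum_limit:
  assumes Sm: "infinitary_sum Sm" and s: "s \<in> dom Sm" "limit_ord (lh s)"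
    and dom: "\<And>\<alpha>. \<alpha> < lh s \<Longrightarrow> seq_restrict s \<alpha> \<in> dom Sm"
  shows "isLub UNIV {the (Sm (seq_restrict s \<alpha>)) | \<alpha>. \<alpha> < lh s} (the (Sm s))"
proof -
  have "\<forall>\<beta><lh s. \<exists>\<alpha>. \<beta> \<le> \<alpha> \<and> \<alpha> < lh s \<and> seq_restrict s \<alpha> \<in> dom Sm"
    using dom by blast
  moreover have "\<forall>s\<in>dom Sm. limit_ord (lh s) \<and>
        (\<forall>\<beta><lh s. \<exists>\<alpha>. \<beta> \<le> \<alpha> \<and> \<alpha> < lh s \<and> seq_restrict s \<alpha> \<in> dom Sm) \<longrightarrow>
        isLub UNIV {the (Sm (seq_restrict s \<alpha>)) | \<alpha>. \<alpha> < lh s \<and> seq_restrict s \<alpha> \<in> dom Sm}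
          (the (Sm s))"
    using Sm unfolding infinitary_sum_def by (elim conjE)
  ultimately have "isLub UNIV {the (Sm (seq_restrict s \<alpha>)) | \<alpha>. \<alpha> < lh s \<and> seq_restrict s \<alpha> \<in> dom Sm}
      (the (Sm s))"
    using s by blast
  moreover have "{the (Sm (seq_restrict s \<alpha>)) | \<alpha>. \<alpha> < lh s \<and> seq_restrict s \<alpha> \<in> dom Sm} =
      {the (Sm (seq_restrict s \<alpha>)) | \<alpha>. \<alpha> < lh s}"
    using dom by blast
  ultimately show ?thesis
    by simp
qed

lemma succ_algebra_generated:
  assumes "G \<subseteq> Pow Y"
  shows "succ_algebra lam Y (generated_succ_algebra lam Y G)"
    and "G \<subseteq> generated_succ_algebra lam Y G"
proof -
  have top: "succ_algebra lam Y (Pow Y)"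
    unfolding succ_algebra_def by blast
  show "G \<subseteq> generated_succ_algebra lam Y G"
    unfolding generated_succ_algebra_def by (rule hull_subset)
  show "succ_algebra lam Y (generated_succ_algebra lam Y G)"
    unfolding succ_algebra_def
  proof (intro conjI ballI allI impI)
    show "generated_succ_algebra lam Y G \<subseteq> Pow Y"
      unfolding generated_succ_algebra_def using assms top by (rule hull_minimal)
  next
    fix A assume "A \<in> generated_succ_algebra lam Y G"
    then show "Y - A \<in> generated_succ_algebra lam Y G"
      unfolding generated_succ_algebra_def hull_def by (auto simp: succ_algebra_def)
  next
    fix F assume F: "F \<subseteq> generated_succ_algebra lam Y G" "|F| \<le>o lam"
    have "\<Union>F \<in> t \<and> Y \<inter> \<Inter>F \<in> t" if "succ_algebra lam Y t" "G \<subseteq> t" for t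
    proof -
      have "F \<subseteq> t"
        using F(1) that unfolding generated_succ_algebra_def hull_def by blast
      then show ?thesis
        using that(1) F(2) unfolding succ_algebra_def by blast
    qed
    then show "\<Union>F \<in> generated_succ_algebra lam Y G" "Y \<inter> \<Inter>F \<in> generated_succ_algebra lam Y G"
      unfolding generated_succ_algebra_def hull_def by blast+
  qed
qed

section \<open>From sums along the ordinals to absorption\<close>

locale ordinal_measure = infinite_succ_algebra lam "topspace T" M
  for lam :: "'l rel" and T :: "'y topology" and M :: "'y set set" +
  fixes Sm :: "('o::wellorder, 's::pos_tot_ord_monoid) ord_seq \<rightharpoonup> 's"
    and \<mu> :: "'y set \<rightharpoonup> 's"
  assumes card: "Card_order lam"
    and big: "lam <o |UNIV :: 'o set|"
    and sum: "infinitary_sum Sm"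
    and meas: "succ_measure lam T M Sm \<mu>"
begin

abbreviation m :: "'y set \<Rightarrow> 's" where "m A \<equiv> the (\<mu> A)"

lemma M_UN: "A ` J \<subseteq> M \<Longrightarrow> |J| \<le>o lam \<Longrightarrow> (\<Union>i\<in>J. A i) \<in> M"
  using M_Union[of "A ` J"] ordLeq_transitive[OF card_of_image] by blast

lemma measure_mono: "A \<in> M \<Longrightarrow> B \<in> M \<Longrightarrow> A \<subseteq> B \<Longrightarrow> m A \<le> m B"
  using meas unfolding succ_measure_def by blast

lemma measure_empty: "m {} = 0"
  using meas unfolding succ_measure_def by simp

lemma measure_UN:
  fixes \<gamma> :: 'o
  assumes "|{..<\<gamma>}| \<le>o lam" "A ` {..<\<gamma>} \<subseteq> M" "disjoint_family_on A {..<\<gamma>}"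
  shows "Sm (mk_seq \<gamma> (\<lambda>i. m (A i))) = Some (m (\<Union>i<\<gamma>. A i))"
proof -
  have "mk_seq \<gamma> (\<lambda>i. m (A i)) \<in> dom Sm \<and> \<mu> (\<Union>i<\<gamma>. A i) = Sm (mk_seq \<gamma> (\<lambda>i. m (A i)))"
    using meas ord_below_succI[OF card assms(1)] assms(2,3) unfolding succ_measure_def by blast
  then show ?thesis
    by auto
qed

lemma measure_Un:
  assumes "A \<in> M" "B \<in> M" "A \<inter> B = {}"
  shows "m (A \<union> B) = m A + m B"
proof -
  have "infinite (UNIV :: 'o set)"
  proof
    assume "finite (UNIV :: 'o set)"
    then have "|UNIV :: 'o set| \<le>o lam"
      by (intro countable_le countable_finite)
    then show False
      using big not_ordLess_ordLeq by blast
  qed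
  then obtain z e t :: 'o where o: "z < e" "{..<t} = {z, e}"
    by (rule ordinal_two)
  define C where "C i = (if i = z then A else B)" for i
  let ?s = "mk_seq t (\<lambda>i. m (C i))"
  have "Sm ?s = Some (m (\<Union>i<t. C i))"
    using o assms by (intro measure_UN countable_le) (auto simp: C_def disjoint_family_on_def)
  moreover have "(\<Union>i<t. C i) = A \<union> B"
    using o by (auto simp: C_def)
  ultimately have s: "Sm ?s = Some (m (A \<union> B))"
    by simp
  then have "Sm ?s = Some (sum_list (map (snd ?s) (sorted_list_of_set {..<lh ?s})))"
    using o by (intro infinitary_sum_finite[OF sum]) (auto simp: mk_seq_def)
  \<comment> \<open>\<open>z < e\<close> fixes the order of the summands; addition need not
    commute.\<close>
  moreover have "sorted_list_of_set {z, e} = [z, e]"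
    using o(1) sorted_list_of_set_insert_remove[of "{e}" z] by (simp add: less_imp_le)
  moreover have "e \<noteq> z"
    using o(1) by simp
  ultimately show ?thesis
    using s o(2) by (simp add: mk_seq_def C_def del: sorted_list_of_set_insert_remove)
qed

text \<open>Induction on the length. The axioms of \<open>Sm\<close> do not determine sums of
  infinite successor length, so the last set is split off with \<open>measure_Un\<close>; at limits,
  continuity gives a least upper bound of values in \<open>I\<close>.\<close>

lemma measure_UN_absorb:
  fixes \<gamma> :: 'o
  assumes I: "absorbing I"
    and \<gamma>: "|{..<\<gamma>}| \<le>o lam" and A: "A ` {..<\<gamma>} \<subseteq> M" and AI: "\<And>i. i < \<gamma> \<Longrightarrow> m (A i) \<in> I"
  shows "m (\<Union>i<\<gamma>. A i) \<in> I"
  using \<gamma> A AI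
proof (induction \<gamma> rule: less_induct)
  case (less \<gamma>)
  note A = less.prems(2,3)
  have le: "|{..<\<alpha>}| \<le>o lam" if "\<alpha> \<le> \<gamma>" for \<alpha>
  proof -
    have "{..<\<alpha>} \<subseteq> {..<\<gamma>}"
      using that by auto
    then show ?thesis
      using less.prems(1) card_of_mono1 ordLeq_transitive by blast
  qed
  have UM: "(\<Union>i<\<alpha>. A i) \<in> M" if "\<alpha> \<le> \<gamma>" for \<alpha>
    using that A(1) by (intro M_UN le) auto
  have IH: "m (\<Union>i<\<alpha>. A i) \<in> I" if "\<alpha> < \<gamma>" for \<alpha>
    using that A by (intro less.IH le) auto
  \<comment> \<open>Disjoint pieces with the same partial unions as \<open>A\<close>, to which
    additivity applies.\<close>
  define D where "D i = A i - (\<Union>j<i. A j)" for i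
  have DM: "D i \<in> M" if "i < \<gamma>" for i
    unfolding D_def using that A(1) by (intro M_Diff UM) auto
  have UD: "(\<Union>i<\<alpha>. D i) = (\<Union>i<\<alpha>. A i)" for \<alpha>
  proof -
    have "x \<in> (\<Union>i<\<alpha>. D i)" if "x \<in> A i" "i < \<alpha>" for x i
    proof -
      let ?k = "LEAST k. x \<in> A k"
      have "x \<in> A ?k" "?k \<le> i"
        using that(1) by (auto intro: LeastI Least_le)
      moreover have "x \<notin> A j" if "j < ?k" for j
        using not_less_Least[OF that] .
      ultimately have "x \<in> D ?k" "?k < \<alpha>"
        using that(2) by (auto simp: D_def)
      then show ?thesis
        by blast
    qed
    then show ?thesis
      by (auto simp: D_def)
  qed
  have disj: "disjoint_family D"
    unfolding disjoint_family_on_def D_def by (auto elim!: linorder_neqE)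
  have measure_D: "Sm (mk_seq \<alpha> (\<lambda>i. m (D i))) = Some (m (\<Union>i<\<alpha>. A i))" if "\<alpha> \<le> \<gamma>" for \<alpha>
    unfolding UD[symmetric] using that DM disj
    by (intro measure_UN le) (auto simp: disjoint_family_on_def)
  consider "{..<\<gamma>} = {}" | \<beta> where "\<beta> < \<gamma>" "\<And>i. i < \<gamma> \<Longrightarrow> i \<le> \<beta>" | "limit_ord \<gamma>"
    unfolding limit_ord_def by (meson not_less)
  then show ?case
  proof cases
    case 1
    then show ?thesis
      using I by (simp add: measure_empty absorbing_def)
  next
    case 2
    then have eq: "{..<\<gamma>} = insert \<beta> {..<\<beta>}"
      by (auto simp: order.order_iff_strict)
    have "(\<Union>i<\<gamma>. A i) = (\<Union>i<\<beta>. A i) \<union> D \<beta>"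
      unfolding eq D_def by auto
    moreover have "m ((\<Union>i<\<beta>. A i) \<union> D \<beta>) = m (\<Union>i<\<beta>. A i) + m (D \<beta>)"
      using 2(1) by (intro measure_Un UM DM) (auto simp: D_def)
    moreover have "m (D \<beta>) \<le> m (A \<beta>)"
      using 2(1) A(1) by (intro measure_mono DM) (auto simp: D_def)
    then have "m (D \<beta>) \<in> I"
      using I A(2)[OF 2(1)] unfolding absorbing_def by blast
    ultimately show ?thesis
      using I IH[OF 2(1)] unfolding absorbing_def by simp
  next
    case 3
    let ?s = "mk_seq \<gamma> (\<lambda>i. m (D i))"
    have restr: "seq_restrict ?s \<alpha> = mk_seq \<alpha> (\<lambda>i. m (D i))" if "\<alpha> < \<gamma>" for \<alpha>
      using that by (auto simp: seq_restrict_def mk_seq_def restrict_def fun_eq_iff)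
    have lh: "lh ?s = \<gamma>"
      by (simp add: mk_seq_def)
    have dom: "seq_restrict ?s \<alpha> \<in> dom Sm" if "\<alpha> < \<gamma>" for \<alpha>
      using measure_D[of \<alpha>] that by (auto simp: restr)
    have "isLub UNIV {the (Sm (seq_restrict ?s \<alpha>)) | \<alpha>. \<alpha> < lh ?s} (the (Sm ?s))"
      using measure_D[of \<gamma>] 3 dom by (intro infinitary_sum_limit[OF sum]) (auto simp: lh)
    \<comment> \<open>The partial sums are the measures of the partial unions, so the induction
      hypothesis puts them in \<open>I\<close>.\<close>
    moreover have "{the (Sm (seq_restrict ?s \<alpha>)) | \<alpha>. \<alpha> < lh ?s} \<subseteq> I"
      using IH measure_D by (auto simp: lh restr)
    ultimately have "the (Sm ?s) \<in> I"
      using I unfolding absorbing_def by blast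
    then show ?thesis
      using measure_D[of \<gamma>] by simp
  qed
qed

lemma enumerate_le:
  fixes F :: "'b set"
  assumes "|F| \<le>o lam"
  obtains \<gamma> :: 'o and f where "|{..<\<gamma>}| \<le>o lam" "f ` {..<\<gamma>} = F"
proof -
  obtain \<gamma> :: 'o and f where f: "bij_betw f {..<\<gamma>} F"
    using enumerate_by_ordinal[OF ordLeq_ordLess_trans[OF assms big]] .
  then have "|{..<\<gamma>}| =o |F|"
    using card_of_ordIso by blast
  then have "|{..<\<gamma>}| \<le>o lam"
    using assms ordIso_ordLeq_trans by blast
  then show ?thesis
    using f by (intro that[of \<gamma> f]) (simp_all add: bij_betw_def)
qed

lemma measure_Union_absorb:
  assumes "absorbing I" "F \<subseteq> M" "|F| \<le>o lam" "\<And>A. A \<in> F \<Longrightarrow> m A \<in> I"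
  shows "m (\<Union>F) \<in> I"
proof -
  obtain \<gamma> :: 'o and f where f: "|{..<\<gamma>}| \<le>o lam" "f ` {..<\<gamma>} = F"
    using enumerate_le[OF assms(3)] .
  have "m (\<Union>i<\<gamma>. f i) \<in> I"
    using f assms by (intro measure_UN_absorb) auto
  then show ?thesis
    using f(2) by simp
qed

text \<open>The basic open sets of measure below \<open>r\<close> form the cover: those basic sets
  that contain \<open>x\<close> are a local basis of size at most \<open>lam\<close>, and their
  measures have infimum \<open>0\<close>.\<close>

lemma continuous_small_cover:
  assumes cont: "\<forall>x\<in>topspace T. {x} \<in> M \<and> \<mu> {x} = Some 0"
    and opens: "{U. openin T U} \<subseteq> M"
    and B: "is_base T B" "|B| \<le>o lam" and r: "0 < r"
  shows "\<exists>F\<subseteq>M. |F| \<le>o lam \<and> \<Union>F = topspace T \<and> (\<forall>A\<in>F. m A < r)"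
proof (intro exI conjI ballI)
  let ?F = "{U \<in> B. m U < r}"
  show "?F \<subseteq> M"
    using B(1) opens by (auto simp: is_base_def)
  have "|?F| \<le>o |B|"
    by (rule card_of_mono1) blast
  then show "|?F| \<le>o lam"
    using B(2) ordLeq_transitive by blast
  show "m A < r" if "A \<in> ?F" for A
    using that by simp
  have "x \<in> \<Union>?F" if x: "x \<in> topspace T" for x
  proof -
    let ?L = "{U \<in> B. x \<in> U}"
    have "|?L| \<le>o |B|"
      by (rule card_of_mono1) blast
    then have "|?L| \<le>o lam"
      using B(2) ordLeq_transitive by blast
    then obtain \<gamma> :: 'o and f where f: "|{..<\<gamma>}| \<le>o lam" "f ` {..<\<gamma>} = ?L"
      by (rule enumerate_le)
    have "is_local_basis T x ?L"
      unfolding is_local_basis_def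
    proof (intro conjI ballI allI impI)
      fix V assume "openin T V \<and> x \<in> V"
      then obtain B' where "B' \<subseteq> B" "V = \<Union>B'" "x \<in> V"
        using B(1) by (auto simp: is_base_def)
      then show "\<exists>U\<in>?L. U \<subseteq> V"
        by blast
    qed (use B(1) in \<open>auto simp: is_base_def\<close>)
    then have "isGlb UNIV ((\<lambda>i. m (f i)) ` {..<\<gamma>}) (m {x})"
      using meas x cont ord_below_succI[OF card f(1)] f(2) unfolding succ_measure_def by auto
    then have glb: "isGlb UNIV ((\<lambda>i. m (f i)) ` {..<\<gamma>}) 0"
      using cont x by simp
    have "\<exists>i<\<gamma>. m (f i) < r"
    proof (rule ccontr)
      assume "\<not> ?thesis"
      then have "r \<le> m (f i)" if "i < \<gamma>" for i
        using that not_less by blast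
      then have "isLb UNIV ((\<lambda>i. m (f i)) ` {..<\<gamma>}) r"
        by (auto intro!: isLbI setgeI)
      then have "r \<le> 0"
        using isGlb_le_isLb[OF glb] by simp
      then show False
        using r by simp
    qed
    then show ?thesis
      using f(2) by blast
  qed
  moreover have "\<Union>?F \<subseteq> topspace T"
    using B(1) openin_subset by (fastforce simp: is_base_def)
  ultimately show "\<Union>?F = topspace T"
    by blast
qed

end

theorem corollary8p11:
  fixes lam :: "'l rel"
    and T :: "'y topology"
    and Y :: "'y set"
    and M :: "'y set set"
    and Sm :: "('o::wellorder, 's::pos_tot_ord_monoid) ord_seq \<rightharpoonup> 's"
  assumes "Card_order lam"
    and "is_card_sup (powers_below lam) lam"
    and "natLeq <o lam"
    and "topspace T = Y"
    and "t0_space T"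
    and "weight T \<le>o lam"
    and "M = generated_succ_algebra lam Y {U. openin T U}"
    and "lam <o |UNIV :: 'o set|"
    and "infinitary_sum Sm"
  shows "\<not> (\<exists>\<mu>. continuous_succ_measure lam T M Sm \<mu>)"
proof
  assume "\<exists>\<mu>. continuous_succ_measure lam T M Sm \<mu>"
  then obtain \<mu> where \<mu>: "succ_measure lam T M Sm \<mu>"
      "\<forall>x\<in>topspace T. {x} \<in> M \<and> \<mu> {x} = Some 0"
    unfolding continuous_succ_measure_def by blast
  have opens: "{U. openin T U} \<subseteq> Pow (topspace T)"
    using openin_subset by blast
  obtain B where B: "is_base T B" "|B| \<le>o lam"
    using weight_base[OF assms(6)] .
  have "succ_algebra lam (topspace T) M"
    using succ_algebra_generated(1)[OF opens] assms(4,7) by simp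
  then interpret ordinal_measure lam T M Sm \<mu>
    using ordLess_imp_ordLeq[OF assms(3)] assms(1,8,9) \<mu>(1) by unfold_locales
  have opens_M: "{U. openin T U} \<subseteq> M"
    using succ_algebra_generated(2)[OF opens] assms(4,7) by simp
  \<comment> \<open>The measure meets the abstract hypotheses, so \<open>total_null\<close>
    contradicts the positive measure of the whole space.\<close>
  interpret absorbing_measure lam "topspace T" M m
  proof unfold_locales
    show "|UNIV :: (nat \<Rightarrow> nat) set| \<le>o lam"
      using assms(1-3) by (rule continuum_le_of_powers_below)
    show "m (\<Union>F) \<in> I" if "absorbing I" "F \<subseteq> M" "|F| \<le>o lam" "\<And>A. A \<in> F \<Longrightarrow> m A \<in> I" for I F
      using that by (rule measure_Union_absorb)
  qed (fact measure_empty measure_mono measure_Un continuous_small_cover[OF \<mu>(2) opens_M B])+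
  have "0 < m (topspace T)"
    using \<mu>(1) by (simp add: succ_measure_def)
  then show False
    using total_null by simp
qed

end
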